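(* Let $I, J \subseteq \mathbb{R}$ be intervals, and let $f, g : I \to \mathbb{R}$. If for any $x, y \in I$ and any $p, q > 0$ with $p + q = 1$ we have $$p f(x) + q f(y) + g(px + qy) \in J,$$ then for any $n \geq 1$, any $x_1,\ldots,x_n \in I$ and any $\lambda_1,\ldots,\lambda_n > 0$ with $\sum_{i=1}^n \lambda_i = 1$, we have $$\sum_{i=1}^n \lambda_i f(x_i) + g\left( \sum_{i=1}^n \lambda_i x_i \right) \in J.$$ *)

theory Defs
  imports "HOL-Analysis.Analysis"
begin

end

theory Submission
  imports Defs
begin

text \<open>A finite distribution on the line with mean \<open>m\<close> is a mixture of distributions that have
  the same mean \<open>m\<close> and at most two atoms each. Keeping the mean fixed keeps the
  argument of \<open>g\<close> fixed, so the \<open>n\<close>-point expression is a weighted average of two-point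
  expressions, all of which lie in \<open>J\<close>; hence so does the average, as \<open>J\<close> is convex.

  It is enough to know that some two-point expression lies below the average and some
  lies above it (in the weak sense). The first is lemma \<open>two_point_below_mean\<close>, and the second
  is the same lemma applied to \<open>- f\<close>.\<close>

text \<open>After centring both coordinates, the claim concerns points \<open>(a i, u i)\<close> of the plane whose
  barycentre is the origin. Let \<open>S\<close> be the first moment of the points on the right, which is minus
  that of the points on the left. If \<open>S > 0\<close>, giving the pair of a left point \<open>i\<close> and a right point \<open>j\<close> the
  weight \<open>l i * l j * (a j - a i) / S\<close> writes the distribution as a mixture of two-point ones with
  \<open>a\<close>-mean zero. Their \<open>u\<close>-means average to zero, so one of them is not positive. Points with
  \<open>a j = 0\<close> count as right points, which is why \<open>p = 0\<close> has to be admitted.\<close>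

lemma two_point_below_mean:
  fixes l a u :: "'i \<Rightarrow> real"
  assumes fin: "finite A" and ne: "A \<noteq> {}"
    and pos: "\<And>i. i \<in> A \<Longrightarrow> l i > 0"
    and a0: "(\<Sum>i\<in>A. l i * a i) = 0" and u0: "(\<Sum>i\<in>A. l i * u i) = 0"
  obtains i j p q where "i \<in> A" "j \<in> A" "p \<ge> 0" "q \<ge> 0" "p + q = 1"
    "p * a i + q * a j = 0" "p * u i + q * u j \<le> 0"
proof -
  define L where "L = {i\<in>A. a i < 0}"
  define R where "R = {i\<in>A. a i \<ge> 0}"
  have finL: "finite L" and finR: "finite R" using fin by (auto simp: L_def R_def)
  have split: "(\<Sum>i\<in>A. h i) = (\<Sum>i\<in>L. h i) + (\<Sum>i\<in>R. h i)" for h :: "'i \<Rightarrow> real"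
  proof -
    have "A = L \<union> R" "L \<inter> R = {}" by (auto simp: L_def R_def)
    then show ?thesis using finL finR by (simp add: sum.union_disjoint)
  qed
  show thesis
  proof (cases "L = {}")
    case True
    \<comment> \<open>No point on the left: the mean zero forces every \<open>a i\<close> to vanish, and one point suffices.\<close>
    have nonneg: "a i \<ge> 0" if "i \<in> A" for i
      using that True by (force simp: L_def)
    have zero: "a i = 0" if "i \<in> A" for i
    proof -
      have "\<forall>i\<in>A. l i * a i = 0"
        using a0 fin nonneg pos by (subst sum_nonneg_eq_0_iff[symmetric]) (auto simp: less_imp_le)
      then show ?thesis using that pos by fastforce
    qed
    have "\<exists>i\<in>A. u i \<le> 0"
    proof (rule ccontr)
      assume "\<not> ?thesis"
      then have "0 < (\<Sum>i\<in>A. l i * u i)"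
        using pos by (intro sum_pos fin ne) auto
      then show False using u0 by simp
    qed
    then obtain i where "i \<in> A" "u i \<le> 0" by blast
    then show thesis using that[of i i 1 0] zero by simp
  next
    case False
    define S where "S = (\<Sum>j\<in>R. l j * a j)"
    have S_left: "(\<Sum>i\<in>L. l i * a i) = - S"
      using a0 split[of "\<lambda>i. l i * a i"] by (simp add: S_def)
    have "(\<Sum>i\<in>L. - (l i * a i)) > 0"
      using pos by (intro sum_pos finL False) (auto simp: L_def mult_pos_neg)
    then have "S > 0" using S_left by (simp add: sum_negf)
    then have "R \<noteq> {}" by (auto simp: S_def)
    have "(\<Sum>i\<in>L. \<Sum>j\<in>R. l i * l j * (a j * u i - a i * u j))
        = (\<Sum>i\<in>L. l i * u i) * S - (\<Sum>i\<in>L. l i * a i) * (\<Sum>j\<in>R. l j * u j)"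
      unfolding S_def sum_product sum_subtractf[symmetric]
      by (intro sum.cong refl) (simp add: algebra_simps)
    also have "\<dots> = S * (\<Sum>i\<in>A. l i * u i)"
      unfolding S_left split[of "\<lambda>i. l i * u i"] by (simp add: algebra_simps)
    finally have total: "(\<Sum>i\<in>L. \<Sum>j\<in>R. l i * l j * (a j * u i - a i * u j)) = 0"
      using u0 by simp
    have "\<exists>i\<in>L. \<exists>j\<in>R. a j * u i - a i * u j \<le> 0"
    proof (rule ccontr)
      assume "\<not> ?thesis"
      then have "a j * u i - a i * u j > 0" if "i \<in> L" "j \<in> R" for i j
        using that by (meson not_le)
      then have "0 < (\<Sum>i\<in>L. \<Sum>j\<in>R. l i * l j * (a j * u i - a i * u j))"
        using pos by (intro sum_pos finL finR False \<open>R \<noteq> {}\<close> mult_pos_pos)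
          (auto simp: L_def R_def)
      then show False using total by simp
    qed
    then obtain i j where ij: "i \<in> L" "j \<in> R" and le: "a j * u i - a i * u j \<le> 0"
      by blast
    have ai: "a i < 0" and aj: "a j \<ge> 0" and mem: "i \<in> A" "j \<in> A"
      using ij by (auto simp: L_def R_def)
    define d where "d = a j - a i"
    have d: "d > 0" using ai aj by (simp add: d_def)
    show thesis
    proof (rule that[OF mem, of "a j / d" "- a i / d"])
      show "a j / d + - a i / d = 1"
        using d by (simp add: d_def flip: diff_divide_distrib)
      show "a j / d * u i + - a i / d * u j \<le> 0"
        using le d by (simp add: divide_nonpos_pos flip: diff_divide_distrib)
    qed (use ai aj d in \<open>auto simp: divide_nonpos_pos\<close>)
  qed
qed

theorem theorem8p2:
  fixes I J :: "real set" and f g :: "real \<Rightarrow> real"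
  assumes "is_interval I" and "is_interval J"
    and "\<And>x y p q :: real. x \<in> I \<Longrightarrow> y \<in> I \<Longrightarrow> p > 0 \<Longrightarrow> q > 0 \<Longrightarrow> p + q = 1
           \<Longrightarrow> p * f x + q * f y + g (p * x + q * y) \<in> J"
  shows "\<forall>n::nat. n \<ge> 1 \<longrightarrow> (\<forall>(x :: nat \<Rightarrow> real) (l :: nat \<Rightarrow> real).
           (\<forall>i\<in>{1..n}. x i \<in> I) \<longrightarrow> (\<forall>i\<in>{1..n}. l i > 0) \<longrightarrow> (\<Sum>i=1..n. l i) = 1 \<longrightarrow>
           (\<Sum>i=1..n. l i * f (x i)) + g (\<Sum>i=1..n. l i * x i) \<in> J)"
proof (intro allI impI)
  fix n :: nat and x l :: "nat \<Rightarrow> real"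
  assume n: "n \<ge> 1" and xI: "\<forall>i\<in>{1..n}. x i \<in> I" and pos: "\<forall>i\<in>{1..n}. l i > 0"
    and one: "(\<Sum>i=1..n. l i) = 1"
  define m where "m = (\<Sum>i=1..n. l i * x i)"
  define v where "v = (\<Sum>i=1..n. l i * f (x i))"
  \<comment> \<open>A degenerate pair, with one weight zero, is the pair of equal points with weights one half.\<close>
  have single: "f y + g y \<in> J" if "y \<in> I" for y
    using assms(3)[OF that that, of "1/2" "1/2"] by simp
  have two: "p * f y + q * f z + g (p * y + q * z) \<in> J"
    if yz: "y \<in> I" "z \<in> I" and pq: "p \<ge> 0" "q \<ge> 0" "p + q = 1" for y z p q
  proof -
    consider "p = 0" "q = 1" | "p = 1" "q = 0" | "p > 0" "q > 0"
      using pq by linarith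
    then show ?thesis using yz pq assms(3) single by cases auto
  qed
  have centre: "(\<Sum>i=1..n. l i * (h i - (\<Sum>i=1..n. l i * h i))) = 0" for h
    using one by (simp add: right_diff_distrib sum_subtractf flip: sum_distrib_right)
  \<comment> \<open>The sign \<open>c\<close> treats the lower and the upper two-point expression at once.\<close>
  have bound: "\<exists>w. c * w \<le> c * v \<and> w + g m \<in> J" for c :: real
  proof -
    obtain i j p q where ij: "i \<in> {1..n}" "j \<in> {1..n}" and pq: "p \<ge> 0" "q \<ge> 0" "p + q = 1"
      and mean: "p * (x i - m) + q * (x j - m) = 0"
      and le: "p * (c * (f (x i) - v)) + q * (c * (f (x j) - v)) \<le> 0"
    proof (rule two_point_below_mean[of "{1..n}" l "\<lambda>i. x i - m" "\<lambda>i. c * (f (x i) - v)"])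
      show "(\<Sum>i=1..n. l i * (x i - m)) = 0"
        unfolding m_def by (rule centre)
      have "(\<Sum>i=1..n. l i * (f (x i) - v)) = 0"
        unfolding v_def by (rule centre)
      then show "(\<Sum>i=1..n. l i * (c * (f (x i) - v))) = 0"
        by (simp add: mult.left_commute flip: sum_distrib_left)
    qed (use n pos in auto)
    have q: "q = 1 - p" using pq by simp
    have "p * x i + q * x j = m"
      using mean unfolding q by (simp add: algebra_simps)
    moreover have "c * (p * f (x i) + q * f (x j)) \<le> c * v"
      using le unfolding q by (simp add: algebra_simps)
    ultimately show ?thesis
      using two[of "x i" "x j" p q] xI ij pq by auto
  qed
  obtain w\<^sub>1 w\<^sub>2 where "w\<^sub>1 \<le> v" "w\<^sub>1 + g m \<in> J" "v \<le> w\<^sub>2" "w\<^sub>2 + g m \<in> J"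
    using bound[of 1] bound[of "-1"] by auto
  then have "v + g m \<in> J"
    using assms(2) by (auto intro: mem_is_interval_1_I[of J "w\<^sub>1 + g m" "w\<^sub>2 + g m"])
  then show "(\<Sum>i=1..n. l i * f (x i)) + g (\<Sum>i=1..n. l i * x i) \<in> J"
    by (simp add: v_def m_def)
qed

end
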